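(* Let $m,r,f\in\mathcal C\setminus\{0\}$ be such that $\langle m,r\rangle$ is not a $\mathcal C$-semigroup, $m\prec r\prec f$, $r\notin\langle m\rangle$, $f\notin\langle m,r\rangle$, and such that whenever two elements of $\langle m,r\rangle$ are consecutive, at least one of them is greater than $f$ with respect to $\preceq$. Then $$S=\langle m,r\rangle\cup\Delta(f)\in\mathcal A(f)\quad\text{and}\quad\operatorname{rank}_{\mathcal A(f)}(S)=2.$$ Moreover, every $\mathcal A$-semigroup with $\mathcal A(f)$-rank equal to two, such that its multiplicity and ratio do not generate a $\mathcal C$-semigroup, is of this form (for some $m,r\in\mathcal C\setminus\{0\}$ such that $\langle m,r\rangle$ is not a $\mathcal C$-semigroup, $m\prec r\prec f$, $r\notin\langle m\rangle$, $f\notin\langle m,r\rangle$, and whenever two elements of $\langle m,r\rangle$ are consecutive, at least one of them is greater than $f$ with respect to $\preceq$).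
   Context: Notation: $\mathbb N=\{0,1,2,\dots\}$, $p\ge 1$, and $\Lambda=\{e_1,\dots,e_p\}$ is the canonical basis of $\mathbb N^p$; $\langle A\rangle$ is the submonoid of $\mathbb N^p$ generated by $A$. Two elements $x,y\in\mathbb N^p$ are consecutive if $y-x\in\Lambda$ or $x-y\in\Lambda$. $\mathcal C\subseteq\mathbb N^p$ is a fixed non-negative integer cone (the set of points of $\mathbb N^p$ lying in a finitely generated rational convex cone), with at least $p$ extremal rays. A $\mathcal C$-semigroup is a finitely generated submonoid $S\subseteq\mathcal C$ of $\mathbb N^p$ such that the minimal integer cone containing $S$ is $\mathcal C$ and $\mathcal H(S)=\mathcal C\setminus S$ is finite. A monomial order $\preceq$ on $\mathbb N^p$ is fixed: a total order compatible with addition with $0\preceq x$ for all $x$; it is assumed that $\{x\in\mathcal C\mid x\preceq k\}$ is finite for every $k\in\mathcal C$. $\operatorname{Fb}(S)=\max_\preceq\mathcal H(S)$ (and $-\sum_i e_i$ if $\mathcal H(S)=\emptyset$), $\operatorname{N}(S)=\{x\in S\mid x\prec\operatorname{Fb}(S)\}$; the multiplicity is $\operatorname{m}(S)=\min_\preceq(S\setminus\{0\})$ and the ratio is $\operatorname{r}(S)=\min_\preceq(S\setminus\langle\operatorname{m}(S)\rangle)$. A $\mathcal C$-semigroup $S$ is an $\mathcal A$-semigroup if for every $s\in S$ and $e\in\Lambda$ the set $\{s,s+e\}$ is not contained in $\operatorname{N}(S)$. $\mathcal A(f)$ is the set of all $\mathcal A$-semigroups $S$ with $\operatorname{Fb}(S)=f$,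 and $\Delta(f)=\{0\}\cup\{x\in\mathcal C\mid x\succ f\}$. A set $X$ is an $\mathcal A(f)$-set if $X\cap\Delta(f)=\emptyset$ and there is $S\in\mathcal A(f)$ with $X\subset S$. For an $\mathcal A(f)$-set $X$, $\mathcal A(f)[X]$ is the intersection of all elements of $\mathcal A(f)$ containing $X$. $X$ is an $\mathcal A(f)$-system of generators of $S$ if $X$ is an $\mathcal A(f)$-set and $S=\mathcal A(f)[X]$; it is minimal if no proper subset $Y\subsetneq X$ satisfies $\mathcal A(f)[Y]=S$. Every $S\in\mathcal A(f)$ has a unique minimal $\mathcal A(f)$-system of generators; its cardinality is $\operatorname{rank}_{\mathcal A(f)}(S)$ (the $\mathcal A(f)$-rank). *)

theory Defs
  imports "HOL-Analysis.Analysis"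
begin

text \<open>
  The space \<open>\<nat>\<^sup>p\<close> is rendered as \<open>nat ^ 'p\<close> with \<open>p = CARD('p)\<close>.  The monomial order is a relation
  parameter \<open>le\<close>; the componentwise order that the library puts on \<open>nat ^ 'p\<close> plays no role.
\<close>

definition vec_of_nat :: "nat ^ 'p \<Rightarrow> ('a :: semiring_1) ^ 'p"
  where "vec_of_nat x = (\<chi> i. of_nat (x $ i))"

definition canonical_basis :: "(nat ^ 'p) set"
  where "canonical_basis = {axis i 1 | i. True}"

text \<open>Subtraction on \<open>nat ^ 'p\<close> truncates, so differences are expressed additively.\<close>

definition consecutive :: "nat ^ 'p \<Rightarrow> nat ^ 'p \<Rightarrow> bool"
  where "consecutive x y \<longleftrightarrow> (\<exists>e \<in> canonical_basis. y = x + e \<or> x = y + e)"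

definition submonoid :: "('a :: monoid_add) set \<Rightarrow> bool"
  where "submonoid M \<longleftrightarrow> 0 \<in> M \<and> (\<forall>x \<in> M. \<forall>y \<in> M. x + y \<in> M)"

definition monoid_span :: "('a :: monoid_add) set \<Rightarrow> 'a set"
  where "monoid_span A = submonoid hull A"


definition integer_cone :: "(nat ^ 'p) set \<Rightarrow> bool"
  where "integer_cone C \<longleftrightarrow>
    (\<exists>A :: (real ^ 'p) set. finite A \<and> (\<forall>a \<in> A. \<forall>i. a $ i \<in> \<rat>) \<and>
       C = {x. vec_of_nat x \<in> convex_cone hull A})"

text \<open>
  The cone spanned by \<open>C\<close> lies in the non-negative orthant, hence contains no line, and its
  extremal rays are its one-dimensional faces.
\<close>

definition extremal_rays :: "(nat ^ 'p) set \<Rightarrow> (real ^ 'p) set set"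
  where "extremal_rays C = {R. R face_of (convex_cone hull (vec_of_nat ` C)) \<and> aff_dim R = 1}"

definition minimal_integer_cone :: "(nat ^ 'p) set \<Rightarrow> (nat ^ 'p) set \<Rightarrow> bool"
  where "minimal_integer_cone S C \<longleftrightarrow>
    integer_cone C \<and> S \<subseteq> C \<and> (\<forall>D. integer_cone D \<and> S \<subseteq> D \<longrightarrow> C \<subseteq> D)"

definition C_semigroup :: "(nat ^ 'p) set \<Rightarrow> (nat ^ 'p) set \<Rightarrow> bool"
  where "C_semigroup C S \<longleftrightarrow>
    S \<subseteq> C \<and> submonoid S \<and> (\<exists>A. finite A \<and> S = monoid_span A) \<and>
    minimal_integer_cone S C \<and> finite (C - S)"


definition monomial_order :: "(nat ^ 'p \<Rightarrow> nat ^ 'p \<Rightarrow> bool) \<Rightarrow> bool"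
  where "monomial_order le \<longleftrightarrow>
    reflp le \<and> transp le \<and> antisymp le \<and> totalp le \<and>
    (\<forall>x y z. le x y \<longrightarrow> le (x + z) (y + z)) \<and> (\<forall>x. le 0 x)"

definition strict :: "('a \<Rightarrow> 'a \<Rightarrow> bool) \<Rightarrow> 'a \<Rightarrow> 'a \<Rightarrow> bool"
  where "strict le x y \<longleftrightarrow> le x y \<and> x \<noteq> y"

text \<open>
  The Frobenius element may be \<open>- (\<Sum>i. e\<^sub>i)\<close>, which lies outside \<open>\<nat>\<^sup>p\<close>.  It is compared with elements
  of \<open>\<nat>\<^sup>p\<close> by means of the unique translation-invariant extension of the monomial order to \<open>\<int>\<^sup>p\<close>.
\<close>

definition int_le ::
    "(nat ^ 'p \<Rightarrow> nat ^ 'p \<Rightarrow> bool) \<Rightarrow> int ^ 'p \<Rightarrow> int ^ 'p \<Rightarrow> bool"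
  where "int_le le u v \<longleftrightarrow>
    (\<exists>a b w. u + vec_of_nat w = vec_of_nat a \<and> v + vec_of_nat w = vec_of_nat b \<and> le a b)"

definition min_wrt :: "('a \<Rightarrow> 'a \<Rightarrow> bool) \<Rightarrow> 'a set \<Rightarrow> 'a"
  where "min_wrt le A = (THE x. x \<in> A \<and> (\<forall>y \<in> A. le x y))"

definition max_wrt :: "('a \<Rightarrow> 'a \<Rightarrow> bool) \<Rightarrow> 'a set \<Rightarrow> 'a"
  where "max_wrt le A = (THE x. x \<in> A \<and> (\<forall>y \<in> A. le y x))"

definition Frob ::
    "(nat ^ 'p) set \<Rightarrow> (nat ^ 'p \<Rightarrow> nat ^ 'p \<Rightarrow> bool) \<Rightarrow> (nat ^ 'p) set \<Rightarrow> int ^ 'p"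
  where "Frob C le S =
    (if C - S = {} then - (\<Sum>i \<in> UNIV. axis i 1) else vec_of_nat (max_wrt le (C - S)))"

definition small_elements ::
    "(nat ^ 'p) set \<Rightarrow> (nat ^ 'p \<Rightarrow> nat ^ 'p \<Rightarrow> bool) \<Rightarrow> (nat ^ 'p) set \<Rightarrow> (nat ^ 'p) set"
  where "small_elements C le S =
    {x \<in> S. strict (int_le le) (vec_of_nat x) (Frob C le S)}"

definition multiplicity_of ::
    "(nat ^ 'p \<Rightarrow> nat ^ 'p \<Rightarrow> bool) \<Rightarrow> (nat ^ 'p) set \<Rightarrow> nat ^ 'p"
  where "multiplicity_of le S = min_wrt le (S - {0})"

definition ratio_of ::
    "(nat ^ 'p \<Rightarrow> nat ^ 'p \<Rightarrow> bool) \<Rightarrow> (nat ^ 'p) set \<Rightarrow> nat ^ 'p"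
  where "ratio_of le S = min_wrt le (S - monoid_span {multiplicity_of le S})"


definition A_semigroup ::
    "(nat ^ 'p) set \<Rightarrow> (nat ^ 'p \<Rightarrow> nat ^ 'p \<Rightarrow> bool) \<Rightarrow> (nat ^ 'p) set \<Rightarrow> bool"
  where "A_semigroup C le S \<longleftrightarrow>
    C_semigroup C S \<and>
    (\<forall>s \<in> S. \<forall>e \<in> canonical_basis. \<not> {s, s + e} \<subseteq> small_elements C le S)"

definition A_semigroups ::
    "(nat ^ 'p) set \<Rightarrow> (nat ^ 'p \<Rightarrow> nat ^ 'p \<Rightarrow> bool) \<Rightarrow> int ^ 'p \<Rightarrow> (nat ^ 'p) set set"
  where "A_semigroups C le f = {S. A_semigroup C le S \<and> Frob C le S = f}"

definition Delta ::
    "(nat ^ 'p) set \<Rightarrow> (nat ^ 'p \<Rightarrow> nat ^ 'p \<Rightarrow> bool) \<Rightarrow> int ^ 'p \<Rightarrow> (nat ^ 'p) set"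
  where "Delta C le f = {0} \<union> {x \<in> C. strict (int_le le) f (vec_of_nat x)}"

definition A_set ::
    "(nat ^ 'p) set \<Rightarrow> (nat ^ 'p \<Rightarrow> nat ^ 'p \<Rightarrow> bool) \<Rightarrow> int ^ 'p \<Rightarrow> (nat ^ 'p) set \<Rightarrow> bool"
  where "A_set C le f X \<longleftrightarrow>
    X \<inter> Delta C le f = {} \<and> (\<exists>S \<in> A_semigroups C le f. X \<subseteq> S)"

definition A_closure ::
    "(nat ^ 'p) set \<Rightarrow> (nat ^ 'p \<Rightarrow> nat ^ 'p \<Rightarrow> bool) \<Rightarrow> int ^ 'p \<Rightarrow> (nat ^ 'p) set
      \<Rightarrow> (nat ^ 'p) set"
  where "A_closure C le f X = \<Inter> {S \<in> A_semigroups C le f. X \<subseteq> S}"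

definition A_generators ::
    "(nat ^ 'p) set \<Rightarrow> (nat ^ 'p \<Rightarrow> nat ^ 'p \<Rightarrow> bool) \<Rightarrow> int ^ 'p \<Rightarrow> (nat ^ 'p) set
      \<Rightarrow> (nat ^ 'p) set \<Rightarrow> bool"
  where "A_generators C le f S X \<longleftrightarrow> A_set C le f X \<and> S = A_closure C le f X"

definition minimal_A_generators ::
    "(nat ^ 'p) set \<Rightarrow> (nat ^ 'p \<Rightarrow> nat ^ 'p \<Rightarrow> bool) \<Rightarrow> int ^ 'p \<Rightarrow> (nat ^ 'p) set
      \<Rightarrow> (nat ^ 'p) set \<Rightarrow> bool"
  where "minimal_A_generators C le f S X \<longleftrightarrow>
    A_generators C le f S X \<and> (\<forall>Y. Y \<subset> X \<longrightarrow> A_closure C le f Y \<noteq> S)"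

text \<open>For \<open>S \<in> A_semigroups C le f\<close> the minimal system of generators exists and is unique.\<close>

definition A_rank ::
    "(nat ^ 'p) set \<Rightarrow> (nat ^ 'p \<Rightarrow> nat ^ 'p \<Rightarrow> bool) \<Rightarrow> int ^ 'p \<Rightarrow> (nat ^ 'p) set \<Rightarrow> nat"
  where "A_rank C le f S = card (THE X. minimal_A_generators C le f S X)"

end

theory Submission
  imports Defs
begin

text \<open>
  Everything rests on a description of \<open>\<A>(f)\<close> for \<open>f \<in> C\<close> without finite generation or minimal cones
  (\<open>A_semigroups_iff\<close>): a set \<open>S\<close> belongs to \<open>\<A>(f)\<close> iff it is a submonoid of \<open>C\<close> that misses \<open>f\<close>,
  contains \<open>\<Delta>(f)\<close>, and has no two consecutive elements that are both \<open>\<preceq> f\<close>.  The content of this is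
  that a submonoid of \<open>C\<close> with finite complement is automatically a \<open>C\<close>-semigroup.  It spans the cone,
  because a suitable multiple of every point of \<open>C\<close> avoids the finite complement.  It is finitely
  generated by an argument in the manner of Gordan and Dickson (\<open>finite_atoms\<close>): any sequence in an
  integer cone has a subsequence along which each term is the previous one plus an element of the
  cone, so infinitely many irreducible elements cannot exist.

  The description is stable under shrinking the part of \<open>S\<close> that lies below \<open>f\<close>: if \<open>S \<in> \<A>(f)\<close> and
  \<open>X \<subseteq> S\<close>, then \<open>\<langle>X\<rangle> \<union> \<Delta>(f) \<in> \<A>(f)\<close>.  Hence \<open>\<A>(f)[X] = \<langle>X\<rangle> \<union> \<Delta>(f)\<close> (\<open>A_closure_eq\<close>), and generating
  \<open>S\<close> in the sense of \<open>\<A>(f)\<close> means generating, as a monoid, the elements of \<open>S\<close> outside \<open>\<Delta>(f)\<close>.  An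
  atom of \<open>S\<close> outside \<open>\<Delta>(f)\<close> belongs to every such generating set, and each element of \<open>S\<close> is a sum of
  atoms that are no larger than itself.  So the atoms of \<open>S\<close> outside \<open>\<Delta>(f)\<close> form the unique
  minimal \<open>\<A>(f)\<close>-system of generators, and the rank counts them (\<open>A_rank_eq_card_atoms\<close>).

  For \<open>S = \<langle>m, r\<rangle> \<union> \<Delta>(f)\<close> these atoms are exactly \<open>m\<close> and \<open>r\<close>.  Conversely, if \<open>S\<close> has two such atoms
  \<open>m \<prec> r\<close>, then \<open>S = \<langle>m, r\<rangle> \<union> \<Delta>(f)\<close>; all non-zero elements of \<open>S\<close> are \<open>\<succeq> m\<close> and all those outside \<open>\<langle>m\<rangle>\<close> are
  \<open>\<succeq> r\<close>, so \<open>m\<close> is the multiplicity and \<open>r\<close> the ratio of \<open>S\<close>.  The conventional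
  Frobenius element of \<open>S = C\<close> leads to rank zero, so this case does not interfere.
\<close>

section \<open>Submonoids and their atoms\<close>

lemma submonoid_monoid_span: "submonoid (monoid_span A)"
  unfolding monoid_span_def by (rule hull_in) (auto simp: submonoid_def)

lemma monoid_span_zero: "0 \<in> monoid_span A"
  and monoid_span_add: "x \<in> monoid_span A \<Longrightarrow> y \<in> monoid_span A \<Longrightarrow> x + y \<in> monoid_span A"
  using submonoid_monoid_span[of A] by (auto simp: submonoid_def)

lemma monoid_span_superset: "A \<subseteq> monoid_span A"
  unfolding monoid_span_def by (rule hull_subset)

lemma monoid_span_minimal: "A \<subseteq> M \<Longrightarrow> submonoid M \<Longrightarrow> monoid_span A \<subseteq> M"
  unfolding monoid_span_def by (rule hull_minimal)

lemma monoid_span_mono: "A \<subseteq> B \<Longrightarrow> monoid_span A \<subseteq> monoid_span B"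
  unfolding monoid_span_def by (rule hull_mono)

text \<open>
  An element of the span that cannot do without the generator \<open>a\<close> splits off a copy of \<open>a\<close>; for a
  monomial order this bounds it from below by \<open>a\<close>.
\<close>

lemma monoid_span_insert_cases:
  fixes a :: "'a :: comm_monoid_add"
  assumes "x \<in> monoid_span (insert a A)"
  shows "x \<in> monoid_span A \<or> (\<exists>y \<in> monoid_span (insert a A). x = a + y)"
proof -
  let ?M = "{x \<in> monoid_span (insert a A).
    x \<in> monoid_span A \<or> (\<exists>y \<in> monoid_span (insert a A). x = a + y)}"
  have "submonoid ?M"
    unfolding submonoid_def
  proof (intro conjI ballI)
    show "0 \<in> ?M"
      by (simp add: monoid_span_zero)
    fix x y
    assume x: "x \<in> ?M" and y: "y \<in> ?M"
    have "x + y \<in> monoid_span A \<or> (\<exists>z \<in> monoid_span (insert a A). x + y = a + z)"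
    proof (cases "x \<in> monoid_span A \<and> y \<in> monoid_span A")
      case True
      then show ?thesis by (simp add: monoid_span_add)
    next
      case False
      with x y consider z where "z \<in> monoid_span (insert a A)" "x = a + z"
        | z where "z \<in> monoid_span (insert a A)" "y = a + z"
        by auto
      then show ?thesis
      proof cases
        case 1
        then have "x + y = a + (z + y)" by (simp add: add.assoc)
        with 1 y show ?thesis by (auto intro: monoid_span_add)
      next
        case 2
        then have "x + y = a + (x + z)" by (simp add: add.left_commute)
        with 2 x show ?thesis by (auto intro: monoid_span_add)
      qed
    qed
    with x y show "x + y \<in> ?M" by (simp add: monoid_span_add)
  qed
  moreover have "insert a A \<subseteq> ?M"
  proof
    fix b
    assume b: "b \<in> insert a A"
    have "a = a + 0" by simp
    with b monoid_span_superset[of "insert a A"] monoid_span_superset[of A] show "b \<in> ?M"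
      using monoid_span_zero[of "insert a A"] by blast
  qed
  ultimately show ?thesis
    using monoid_span_minimal assms by blast
qed

lemma monoid_span_empty: "monoid_span {} = {0}"
proof
  show "monoid_span {} \<subseteq> {0}"
    by (rule monoid_span_minimal) (auto simp: submonoid_def)
qed (simp add: monoid_span_zero)

definition atoms :: "('a :: monoid_add) set \<Rightarrow> 'a set"
  where "atoms S = {a \<in> S - {0}. \<forall>x \<in> S. \<forall>y \<in> S. a = x + y \<longrightarrow> x = 0 \<or> y = 0}"

text \<open>
  A sum that is an atom has a zero summand, so the elements of \<open>S\<close> that are not an atom outside
  \<open>X\<close> form a submonoid containing \<open>X\<close>.
\<close>

lemma atom_in_generators:
  assumes "submonoid S" "X \<subseteq> S" "a \<in> atoms S" "a \<in> monoid_span X"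
  shows "a \<in> X"
proof -
  let ?M = "{x \<in> S. x \<in> atoms S \<longrightarrow> x \<in> X}"
  have "submonoid ?M"
    unfolding submonoid_def
  proof (intro conjI ballI)
    show "0 \<in> ?M"
      using assms(1) by (simp add: submonoid_def atoms_def)
    fix x y
    assume xy: "x \<in> ?M" "y \<in> ?M"
    have "x = 0 \<or> y = 0" if "x + y \<in> atoms S"
      using that xy unfolding atoms_def by blast
    moreover have "x + y \<in> S"
      using xy assms(1) by (simp add: submonoid_def)
    ultimately show "x + y \<in> ?M"
      using xy by auto
  qed
  then have "monoid_span X \<subseteq> ?M"
    using assms(2) by (intro monoid_span_minimal) auto
  with assms show ?thesis by auto
qed

text \<open>
  Splitting a non-atom into two non-zero summands lowers the coordinate sum, so the process ends with
  atoms.  They are summands of \<open>s\<close>; the bound \<open>a \<le> s\<close> in the componentwise order records this, because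
  only the atoms below the Frobenius element may be used later.
\<close>

lemma mem_monoid_span_atoms_below:
  fixes S :: "(nat ^ 'p) set"
  assumes "s \<in> S"
  shows "s \<in> monoid_span {a \<in> atoms S. a \<le> s}"
  using assms
proof (induction "\<Sum>i\<in>UNIV. s $ i" arbitrary: s rule: less_induct)
  case less
  show ?case
  proof (cases "s = 0 \<or> s \<in> atoms S")
    case True
    then show ?thesis
      using monoid_span_superset[of "{a \<in> atoms S. a \<le> s}"] by (auto simp: monoid_span_zero)
  next
    case False
    then obtain x y where xy: "x \<in> S" "y \<in> S" "s = x + y" "x \<noteq> 0" "y \<noteq> 0"
      using less.prems by (auto simp: atoms_def)
    have "0 < (\<Sum>i\<in>UNIV. z $ i)" if "z \<noteq> 0" for z :: "nat ^ 'p"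
      using that by (intro sum_pos2[where i = "SOME i. z $ i \<noteq> 0"]) (auto simp: vec_eq_iff intro: someI2)
    moreover have "(\<Sum>i\<in>UNIV. s $ i) = (\<Sum>i\<in>UNIV. x $ i) + (\<Sum>i\<in>UNIV. y $ i)"
      by (simp add: xy sum.distrib)
    ultimately have "(\<Sum>i\<in>UNIV. x $ i) < (\<Sum>i\<in>UNIV. s $ i)" "(\<Sum>i\<in>UNIV. y $ i) < (\<Sum>i\<in>UNIV. s $ i)"
      using xy by auto
    then have "x \<in> monoid_span {a \<in> atoms S. a \<le> x}" "y \<in> monoid_span {a \<in> atoms S. a \<le> y}"
      using less.hyps xy by auto
    moreover have "x \<le> s" "y \<le> s"
      using xy by (auto simp: less_eq_vec_def)
    ultimately have "x \<in> monoid_span {a \<in> atoms S. a \<le> s}" "y \<in> monoid_span {a \<in> atoms S. a \<le> s}"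
      using monoid_span_mono[of "{a \<in> atoms S. a \<le> x}" "{a \<in> atoms S. a \<le> s}"]
        monoid_span_mono[of "{a \<in> atoms S. a \<le> y}" "{a \<in> atoms S. a \<le> s}"]
      by (auto intro: order_trans)
    then show ?thesis
      using xy monoid_span_add by blast
  qed
qed

section \<open>Integer cones\<close>

lemma vec_of_nat_nth [simp]: "vec_of_nat x $ i = of_nat (x $ i)"
  by (simp add: vec_of_nat_def)

lemma vec_of_nat_add [simp]: "vec_of_nat (x + y) = vec_of_nat x + vec_of_nat y"
  by (simp add: vec_eq_iff)

lemma vec_of_nat_zero [simp]: "vec_of_nat 0 = 0"
  by (simp add: vec_eq_iff)

lemma vec_of_nat_inject [simp]:
  "vec_of_nat x = (vec_of_nat y :: 'a :: {semiring_1, semiring_char_0} ^ 'p) \<longleftrightarrow> x = y"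
  by (simp add: vec_eq_iff)

lemma integer_cone_submonoid:
  assumes "integer_cone C"
  shows "submonoid C"
  using assms by (auto simp: integer_cone_def submonoid_def convex_cone_hull_contains_0
      intro: convex_cone_hull_add)

lemma integer_cone_multiple_iff:
  assumes "integer_cone C" "n > 0"
  shows "(\<chi> i. n * x $ i) \<in> C \<longleftrightarrow> x \<in> C"
proof -
  obtain A :: "(real ^ 'a) set" where C: "C = {x. vec_of_nat x \<in> convex_cone hull A}"
    using assms(1) by (auto simp: integer_cone_def)
  have mult: "vec_of_nat (\<chi> i. n * x $ i) = real n *\<^sub>R (vec_of_nat x :: real ^ 'a)"
    by (simp add: vec_eq_iff)
  then have "vec_of_nat x = (1 / real n) *\<^sub>R (vec_of_nat (\<chi> i. n * x $ i) :: real ^ 'a)"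
    using assms(2) by simp
  with mult show ?thesis
    unfolding C by (metis convex_cone_hull_mul mem_Collect_eq of_nat_0_le_iff zero_le_divide_1_iff)
qed

lemma convex_cone_hull_finite_subset:
  fixes A :: "'a :: real_vector set"
  assumes "finite A"
  shows "convex_cone hull A \<subseteq> {\<Sum>a\<in>A. l a *\<^sub>R a | l. \<forall>a\<in>A. 0 \<le> l a}"
proof (rule hull_minimal)
  let ?K = "{\<Sum>a\<in>A. l a *\<^sub>R a | l. \<forall>a\<in>A. 0 \<le> l a}"
  show "A \<subseteq> ?K"
  proof
    fix a
    assume a: "a \<in> A"
    then have "a = (\<Sum>b\<in>A. (if b = a then 1 else 0 :: real) *\<^sub>R b)"
      using assms by (simp add: if_distrib[of "\<lambda>c. c *\<^sub>R _"] cong: if_cong)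
    then show "a \<in> ?K"
      by (intro CollectI exI[of _ "\<lambda>b. if b = a then 1 else 0"]) auto
  qed
  show "convex_cone ?K"
    unfolding convex_cone_iff
  proof (intro conjI ballI allI impI)
    show "0 \<in> ?K"
      by (auto intro: exI[of _ "\<lambda>_. 0"])
    fix x y
    assume "x \<in> ?K" "y \<in> ?K"
    then obtain k l where "x = (\<Sum>a\<in>A. k a *\<^sub>R a)" "y = (\<Sum>a\<in>A. l a *\<^sub>R a)"
      "\<forall>a\<in>A. 0 \<le> k a" "\<forall>a\<in>A. 0 \<le> l a"
      by auto
    then show "x + y \<in> ?K"
      by (intro CollectI exI[of _ "\<lambda>a. k a + l a"]) (auto simp: scaleR_add_left sum.distrib)
  next
    fix x and c :: real
    assume "x \<in> ?K" "0 \<le> c"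
    then obtain k where "x = (\<Sum>a\<in>A. k a *\<^sub>R a)" "\<forall>a\<in>A. 0 \<le> k a"
      by auto
    with \<open>0 \<le> c\<close> show "c *\<^sub>R x \<in> ?K"
      by (intro CollectI exI[of _ "\<lambda>a. c * k a"]) (auto simp: scaleR_sum_right)
  qed
qed

lemma convex_cone_hull_sum:
  assumes "finite A" "\<And>a. a \<in> A \<Longrightarrow> 0 \<le> l a"
  shows "(\<Sum>a\<in>A. l a *\<^sub>R a) \<in> convex_cone hull A"
proof -
  have "(\<Sum>a\<in>B. l a *\<^sub>R a) \<in> convex_cone hull A" if "B \<subseteq> A" for B
    using finite_subset[OF that assms(1)] that
    by (induction B) (auto simp: convex_cone_hull_contains_0
        intro: convex_cone_hull_add convex_cone_hull_mul assms(2) hull_inc)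
  then show ?thesis by simp
qed

lemma common_denominator:
  fixes Q :: "real set"
  assumes "finite Q" "Q \<subseteq> \<rat>"
  obtains N :: nat where "N > 0" "\<And>q. q \<in> Q \<Longrightarrow> of_nat N * q \<in> \<int>"
proof -
  have "\<exists>N>0. \<forall>q\<in>Q. of_nat N * q \<in> \<int>"
    using assms
  proof (induction Q)
    case empty
    then show ?case by auto
  next
    case (insert q Q)
    then obtain N where N: "N > 0" "\<forall>q\<in>Q. of_nat N * q \<in> \<int>"
      by auto
    obtain a b :: int where ab: "b > 0" "q = of_int a / of_int b"
      using insert.prems by (auto elim: Rats_cases')
    have "real (N * nat b) * q = of_int (int N * a)"
      using ab by simp
    then have "real (N * nat b) * q \<in> \<int>"
      by (metis Ints_of_int)
    moreover have "real (N * nat b) * q' \<in> \<int>" if "q' \<in> Q" for q'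
    proof -
      have "real (N * nat b) * q' = of_int b * (real N * q')"
        using ab by simp
      also have "\<dots> \<in> \<int>"
        using N that by (intro Ints_mult[OF Ints_of_int]) blast
      finally show ?thesis .
    qed
    ultimately show ?case
      using N ab by (intro exI[of _ "N * nat b"]) auto
  qed
  with that show ?thesis by blast
qed

text \<open>
  A sequence of natural numbers that decreases is eventually constant, which makes both outcomes of
  the Ramsey-type lemma \<open>seq_monosub\<close> acceptable.
\<close>

lemma nat_seq_mono_subseq:
  fixes s :: "nat \<Rightarrow> nat"
  obtains g :: "nat \<Rightarrow> nat" where "strict_mono g" "mono (s \<circ> g)"
proof -
  obtain g where g: "strict_mono g" "monoseq (\<lambda>n. s (g n))"
    using seq_monosub by blast
  show thesis
  proof (cases "incseq (\<lambda>n. s (g n))")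
    case True
    then show thesis
      by (intro that[OF g(1)]) (simp add: comp_def)
  next
    case False
    then have dec: "decseq (\<lambda>n. s (g n))"
      using g by (simp add: monoseq_iff)
    obtain k where k: "\<And>n. s (g k) \<le> s (g n)"
      using ex_has_least_nat[of "\<lambda>_. True" _ "\<lambda>n. s (g n)"] by auto
    have "s (g (k + n)) = s (g k)" for n
      using k[of "k + n"] decseqD[OF dec, of k "k + n"] by simp
    then have "mono (s \<circ> (\<lambda>n. g (k + n)))"
      by (simp add: mono_def)
    moreover have "strict_mono (\<lambda>n. g (k + n))"
      using g by (simp add: strict_mono_def)
    ultimately show thesis using that by blast
  qed
qed

text \<open>
  This is Dickson's lemma for \<open>\<nat>\<^sup>k\<close>, the coordinates of a sequence of vectors being listed as a finite
  set of sequences.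
\<close>

lemma simultaneous_mono_subseq:
  fixes F :: "(nat \<Rightarrow> nat) set"
  assumes "finite F"
  obtains g :: "nat \<Rightarrow> nat" where "strict_mono g" "\<forall>s \<in> F. mono (s \<circ> g)"
proof -
  have "\<exists>g :: nat \<Rightarrow> nat. strict_mono g \<and> (\<forall>s\<in>F. mono (s \<circ> g))"
    using assms
  proof (induction F)
    case empty
    show ?case by (auto intro: exI[of _ id] strict_monoI)
  next
    case (insert t F)
    then obtain g :: "nat \<Rightarrow> nat" where g: "strict_mono g" "\<forall>s\<in>F. mono (s \<circ> g)"
      by blast
    obtain h :: "nat \<Rightarrow> nat" where h: "strict_mono h" "mono ((t \<circ> g) \<circ> h)"
      by (rule nat_seq_mono_subseq)
    have "mono (s \<circ> (g \<circ> h))" if "s \<in> F" for s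
    proof -
      have "mono (s \<circ> g)" "mono h"
        using g that h by (auto simp: strict_mono_mono)
      then show ?thesis by (simp add: mono_def)
    qed
    moreover have "strict_mono (g \<circ> h)"
      using g h by (simp add: strict_mono_def)
    ultimately show ?case
      using h(2) unfolding comp_assoc by blast
  qed
  with that show ?thesis by blast
qed

text \<open>
  Write \<open>x\<^sub>n = \<Sum>\<^sub>a l\<^sub>n\<^sub>,\<^sub>a a\<close> with non-negative coefficients, and clear denominators so that \<open>N a\<close> is
  integral for each generator \<open>a\<close>.  Taking integer parts \<open>k\<^sub>n\<^sub>,\<^sub>a\<close> of \<open>l\<^sub>n\<^sub>,\<^sub>a / N\<close> leaves a residue
  \<open>\<rho>\<^sub>n = x\<^sub>n - \<Sum>\<^sub>a k\<^sub>n\<^sub>,\<^sub>a N a\<close> that is integral and bounded.  On a subsequence the integer parts and the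
  coordinates of \<open>x\<^sub>n\<close> increase weakly while the residue is constant.  There the differences have non-negative
  coordinates and are non-negative combinations of the generators, so they lie in the cone.  The
  generators themselves need not have non-negative coordinates, which is why the coordinates of \<open>x\<^sub>n\<close>
  are controlled separately.
\<close>

lemma integer_cone_good_subseq:
  fixes x :: "nat \<Rightarrow> nat ^ 'p"
  assumes "integer_cone C" "\<And>n. x n \<in> C"
  obtains g :: "nat \<Rightarrow> nat" where "strict_mono g" "\<forall>i j. i \<le> j \<longrightarrow> (\<exists>d \<in> C. x (g j) = x (g i) + d)"
proof -
  obtain A :: "(real ^ 'p) set" where fin: "finite A" and rat: "\<And>a i. a \<in> A \<Longrightarrow> a $ i \<in> \<rat>"
    and C: "C = {x. vec_of_nat x \<in> convex_cone hull A}"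
    using assms(1) by (auto simp: integer_cone_def)
  define Q where "Q = (\<lambda>(a, i). a $ i) ` (A \<times> (UNIV :: 'p set))"
  have "finite Q" "Q \<subseteq> \<rat>"
    using fin rat by (auto simp: Q_def)
  then obtain N :: nat where N: "N > 0" "\<And>q. q \<in> Q \<Longrightarrow> of_nat N * q \<in> \<int>"
    using common_denominator by blast
  have int: "real N * a $ i \<in> \<int>" if "a \<in> A" for a i
    using that N(2) by (force simp: Q_def)
  have "\<exists>l. (\<forall>a\<in>A. 0 \<le> l a) \<and> vec_of_nat (x n) = (\<Sum>a\<in>A. l a *\<^sub>R a)" for n
    using assms(2)[of n] convex_cone_hull_finite_subset[OF fin] unfolding C by auto
  then obtain l where l: "\<And>n a. a \<in> A \<Longrightarrow> 0 \<le> l n a"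
    "\<And>n. vec_of_nat (x n) = (\<Sum>a\<in>A. l n a *\<^sub>R a)"
    by metis
  define k where "k n a = nat \<lfloor>l n a / N\<rfloor>" for n a
  define \<rho> where "\<rho> n = vec_of_nat (x n) - (\<Sum>a\<in>A. (real (k n a) * real N) *\<^sub>R a)" for n
  define b where "b i = nat \<lceil>\<Sum>a\<in>A. real N * \<bar>a $ i\<bar>\<rceil>" for i
  have "real (k n a) * real N * a $ i \<in> \<int>" if "a \<in> A" for n a i
    using Ints_mult[OF Ints_of_nat int[OF that]] by (simp add: mult.assoc)
  then have \<rho>_int: "\<rho> n $ i \<in> \<int>" for n i
    unfolding \<rho>_def by (auto intro!: Ints_diff Ints_sum)
  have \<rho>_bound: "\<bar>\<rho> n $ i\<bar> \<le> real (b i)" for n i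
  proof -
    have frac: "\<bar>l n a - real (k n a) * real N\<bar> \<le> real N" if "a \<in> A" for a
    proof -
      have "real (k n a) \<le> l n a / N" "l n a / N < real (k n a) + 1"
        using l(1)[OF that, of n] by (auto simp: k_def)
      then show ?thesis
        using N(1) by (auto simp: field_simps)
    qed
    have "\<rho> n $ i = (\<Sum>a\<in>A. (l n a - real (k n a) * real N) * a $ i)"
      by (simp add: \<rho>_def l(2) sum_subtractf left_diff_distrib flip: vec_of_nat_nth)
    also have "\<bar>\<dots>\<bar> \<le> (\<Sum>a\<in>A. \<bar>(l n a - real (k n a) * real N) * a $ i\<bar>)"
      by (rule sum_abs)
    also have "\<dots> \<le> (\<Sum>a\<in>A. real N * \<bar>a $ i\<bar>)"
      using frac by (intro sum_mono) (auto simp: abs_mult intro: mult_right_mono)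
    also have "\<dots> \<le> real (b i)"
      unfolding b_def by linarith
    finally show ?thesis .
  qed
  \<comment> \<open>The last two families turn the bounded residue into natural numbers with both signs, so that
    monotonicity of both makes it constant.\<close>
  define F where "F = (\<lambda>i n. x n $ i) ` UNIV \<union> (\<lambda>a n. k n a) ` A
      \<union> (\<lambda>i n. nat \<lfloor>real (b i) + \<rho> n $ i\<rfloor>) ` UNIV \<union> (\<lambda>i n. nat \<lfloor>real (b i) - \<rho> n $ i\<rfloor>) ` UNIV"
  have "finite F"
    using fin by (simp add: F_def)
  then obtain g :: "nat \<Rightarrow> nat" where g: "strict_mono g" and mono: "\<forall>s \<in> F. mono (s \<circ> g)"
    by (rule simultaneous_mono_subseq)
  have "\<exists>d \<in> C. x (g j) = x (g i) + d" if "i \<le> j" for i j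
  proof -
    have le: "s (g i) \<le> s (g j)" if "s \<in> F" for s
      using monoD[OF mono[rule_format, OF that] \<open>i \<le> j\<close>] by simp
    have x_le: "x (g i) $ c \<le> x (g j) $ c" for c
      by (rule le[of "\<lambda>n. x n $ c"]) (simp add: F_def)
    have k_le: "k (g i) a \<le> k (g j) a" if "a \<in> A" for a
      by (rule le[of "\<lambda>n. k n a"]) (use that in \<open>simp add: F_def\<close>)
    have "\<rho> (g i) $ c = \<rho> (g j) $ c" for c
    proof -
      have "nat \<lfloor>real (b c) + \<rho> (g i) $ c\<rfloor> \<le> nat \<lfloor>real (b c) + \<rho> (g j) $ c\<rfloor>"
        by (rule le[of "\<lambda>n. nat \<lfloor>real (b c) + \<rho> n $ c\<rfloor>"]) (simp add: F_def)
      moreover have "nat \<lfloor>real (b c) - \<rho> (g i) $ c\<rfloor> \<le> nat \<lfloor>real (b c) - \<rho> (g j) $ c\<rfloor>"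
        by (rule le[of "\<lambda>n. nat \<lfloor>real (b c) - \<rho> n $ c\<rfloor>"]) (simp add: F_def)
      moreover obtain u v :: int where uv: "\<rho> (g i) $ c = of_int u" "\<rho> (g j) $ c = of_int v"
        using \<rho>_int by (meson Ints_cases)
      moreover have "\<bar>u\<bar> \<le> int (b c)" "\<bar>v\<bar> \<le> int (b c)"
        using \<rho>_bound[of "g i" c] \<rho>_bound[of "g j" c] unfolding uv by linarith+
      moreover have "\<lfloor>real (b c) + of_int w\<rfloor> = int (b c) + w"
        "\<lfloor>real (b c) - of_int w\<rfloor> = int (b c) - w" for w
        by linarith+
      ultimately have "u = v"
        by simp
      then show ?thesis by (simp add: uv)
    qed
    then have \<rho>_eq: "\<rho> (g i) = \<rho> (g j)"
      by (simp add: vec_eq_iff)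
    define d where "d = x (g j) - x (g i)"
    have d: "x (g j) = x (g i) + d"
      using x_le by (simp add: d_def vec_eq_iff)
    have "vec_of_nat d = vec_of_nat (x (g j)) - (vec_of_nat (x (g i)) :: real ^ 'p)"
      by (simp add: d)
    also have "\<dots> = (\<Sum>a\<in>A. (real (k (g j) a) * real N) *\<^sub>R a) - (\<Sum>a\<in>A. (real (k (g i) a) * real N) *\<^sub>R a)"
      using \<rho>_eq by (simp add: \<rho>_def algebra_simps)
    also have "\<dots> = (\<Sum>a\<in>A. ((real (k (g j) a) - real (k (g i) a)) * real N) *\<^sub>R a)"
      by (simp add: left_diff_distrib scaleR_diff_left sum_subtractf)
    also have "\<dots> \<in> convex_cone hull A"
      using fin k_le by (intro convex_cone_hull_sum) auto
    finally have "d \<in> C"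
      by (simp add: C)
    with d show ?thesis by blast
  qed
  with g that show thesis by blast
qed

text \<open>
  Along a good subsequence of distinct atoms the differences to the first term are infinitely many
  elements of \<open>C\<close>.  One of them lies in \<open>S\<close> and splits an atom.
\<close>

lemma finite_atoms:
  fixes S :: "(nat ^ 'p) set"
  assumes "integer_cone C" "S \<subseteq> C" "finite (C - S)"
  shows "finite (atoms S)"
proof (rule ccontr)
  assume "infinite (atoms S)"
  then obtain x :: "nat \<Rightarrow> nat ^ 'p" where x: "inj x" "range x \<subseteq> atoms S"
    using infinite_countable_subset by blast
  then have xS: "x n \<in> S" "x n \<noteq> 0" for n
    by (auto simp: atoms_def)
  then have "x n \<in> C" for n
    using assms(2) by blast
  with assms(1) obtain g :: "nat \<Rightarrow> nat"
    where g: "strict_mono g" "\<forall>i j. i \<le> j \<longrightarrow> (\<exists>d \<in> C. x (g j) = x (g i) + d)"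
    by (rule integer_cone_good_subseq)
  then have "\<forall>j. \<exists>d. d \<in> C \<and> x (g j) = x (g 0) + d"
    by blast
  from choice[OF this] obtain d where d: "\<And>j. d j \<in> C" "\<And>j. x (g j) = x (g 0) + d j"
    by blast
  have inj: "inj d"
  proof (rule injI)
    fix i j
    assume "d i = d j"
    then have "x (g i) = x (g j)"
      using d(2)[of i] d(2)[of j] by argo
    then show "i = j"
      using x(1) g(1) by (simp add: inj_eq strict_mono_eq)
  qed
  have "infinite (d ` {1..})"
    using inj by (meson finite_imageD inj_on_subset infinite_Ici subset_UNIV)
  then have "\<not> d ` {1..} \<subseteq> C - S"
    using assms(3) finite_subset by blast
  then obtain j where j: "j \<ge> 1" "d j \<in> S"
    using d(1) by auto
  have "x (g j) \<in> atoms S"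
    using x(2) by auto
  then have "d j = 0"
    using d(2)[of j] j xS by (auto simp: atoms_def)
  with d(2)[of j] have "x (g j) = x (g 0)" by simp
  with x(1) g(1) j show False
    by (simp add: inj_eq strict_mono_eq)
qed

text \<open>
  If \<open>x \<in> C\<close> is non-zero, its multiples are infinitely many elements of \<open>C\<close>, so one of them lies in \<open>S\<close>;
  any integer cone containing that multiple contains \<open>x\<close>.  Hence \<open>C\<close> is the smallest integer cone
  around \<open>S\<close>.
\<close>

lemma C_semigroupI:
  fixes S :: "(nat ^ 'p) set"
  assumes "integer_cone C" "S \<subseteq> C" "submonoid S" "finite (C - S)"
  shows "C_semigroup C S"
proof -
  have "S \<subseteq> monoid_span (atoms S)"
  proof
    fix s
    assume "s \<in> S"
    then show "s \<in> monoid_span (atoms S)"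
      using mem_monoid_span_atoms_below[of s S] monoid_span_mono[of "{a \<in> atoms S. a \<le> s}" "atoms S"]
      by auto
  qed
  moreover have "monoid_span (atoms S) \<subseteq> S"
    using assms(3) by (intro monoid_span_minimal) (auto simp: atoms_def)
  ultimately have gen: "S = monoid_span (atoms S)" by auto
  have "C \<subseteq> D" if D: "integer_cone D" "S \<subseteq> D" for D
  proof
    fix x
    assume x: "x \<in> C"
    show "x \<in> D"
    proof (cases "x = 0")
      case True
      then show ?thesis
        using D assms(3) by (auto simp: submonoid_def)
    next
      case False
      then obtain c where c: "x $ c \<noteq> 0" by (auto simp: vec_eq_iff)
      define h where "h n = (\<chi> i. n * x $ i)" for n
      have "inj h"
        using c by (auto simp: inj_def h_def vec_eq_iff)
      then have "infinite (h ` {1..})"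
        by (meson finite_imageD inj_on_subset infinite_Ici subset_UNIV)
      moreover have "h ` {1..} \<subseteq> C"
        using integer_cone_multiple_iff[OF assms(1)] x by (auto simp: h_def)
      moreover from calculation have "\<not> h ` {1..} \<subseteq> C - S"
        using assms(4) finite_subset by blast
      ultimately obtain n where "n \<ge> 1" "h n \<in> S"
        by auto
      then show ?thesis
        using D integer_cone_multiple_iff[OF D(1), of n x] by (auto simp: h_def)
    qed
  qed
  with assms gen finite_atoms[OF assms(1,2,4)] show ?thesis
    unfolding C_semigroup_def minimal_integer_cone_def by blast
qed

section \<open>The monomial order\<close>

no_notation lesspoll (infixl "\<prec>" 50)

locale ordered_integer_cone =
  fixes C :: "(nat ^ 'p) set"
    and le :: "nat ^ 'p \<Rightarrow> nat ^ 'p \<Rightarrow> bool"  (infix "\<preceq>" 50)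
  assumes integer_cone: "integer_cone C"
    and monomial_order: "monomial_order le"
    and finite_below: "k \<in> C \<Longrightarrow> finite {x \<in> C. x \<preceq> k}"
begin

abbreviation less (infix "\<prec>" 50) where "x \<prec> y \<equiv> strict le x y"

abbreviation A_semigroups_with_Frob (\<open>\<A>\<close>) where "\<A> f \<equiv> A_semigroups C le (vec_of_nat f)"

abbreviation Delta_above (\<open>\<Delta>\<close>) where "\<Delta> f \<equiv> Delta C le (vec_of_nat f)"

lemma le_refl [simp]: "x \<preceq> x"
  and le_trans [trans]: "x \<preceq> y \<Longrightarrow> y \<preceq> z \<Longrightarrow> x \<preceq> z"
  and le_antisym: "x \<preceq> y \<Longrightarrow> y \<preceq> x \<Longrightarrow> x = y"
  and le_add_right: "x \<preceq> y \<Longrightarrow> x + z \<preceq> y + z"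
  and zero_le [simp]: "0 \<preceq> x"
  using monomial_order unfolding monomial_order_def
  by (blast dest: reflpD transpD antisympD)+

lemma not_le: "\<not> x \<preceq> y \<longleftrightarrow> y \<prec> x"
  using monomial_order le_refl le_antisym unfolding monomial_order_def strict_def
  by (metis totalpD)

lemma less_le_trans: "x \<prec> y \<Longrightarrow> y \<preceq> z \<Longrightarrow> x \<prec> z"
  and le_less_trans: "x \<preceq> y \<Longrightarrow> y \<prec> z \<Longrightarrow> x \<prec> z"
  unfolding strict_def using le_trans le_antisym by blast+

lemma less_trans: "x \<prec> y \<Longrightarrow> y \<prec> z \<Longrightarrow> x \<prec> z"
  using le_less_trans by (auto simp: strict_def)

lemma less_not_le: "x \<prec> y \<Longrightarrow> \<not> y \<preceq> x"
  by (simp add: not_le)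

lemma less_asym: "x \<prec> y \<Longrightarrow> \<not> y \<prec> x"
  using less_not_le by (auto simp: strict_def)

lemma le_add: "x \<preceq> x + y" "x \<preceq> y + x"
  using le_add_right[OF zero_le, of x y] by (simp_all add: add.commute)

lemma add_right_le_iff: "x + z \<preceq> y + z \<longleftrightarrow> x \<preceq> y"
proof
  assume le: "x + z \<preceq> y + z"
  show "x \<preceq> y"
  proof (rule ccontr)
    assume "\<not> x \<preceq> y"
    then have "y \<prec> x" by (simp add: not_le)
    then have "y + z \<preceq> x + z" "y \<noteq> x"
      by (auto simp: strict_def le_add_right)
    with le le_antisym show False by fastforce
  qed
qed (rule le_add_right)

lemma componentwise_le_imp_le: "x \<le> y \<Longrightarrow> x \<preceq> y"
  using le_add(1)[of x "y - x"] by (simp add: vec_eq_iff less_eq_vec_def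
      arg_cong[of "x + (y - x)" y "\<lambda>z. x \<preceq> z"])

lemma min_wrt_eq: "x \<in> B \<Longrightarrow> (\<And>y. y \<in> B \<Longrightarrow> x \<preceq> y) \<Longrightarrow> min_wrt le B = x"
  unfolding min_wrt_def using le_antisym by (intro the_equality) auto

lemma max_wrt_eq: "x \<in> B \<Longrightarrow> (\<And>y. y \<in> B \<Longrightarrow> y \<preceq> x) \<Longrightarrow> max_wrt le B = x"
  unfolding max_wrt_def using le_antisym by (intro the_equality) auto

lemma finite_has_greatest:
  assumes "finite B" "B \<noteq> {}"
  obtains x where "x \<in> B" "\<And>y. y \<in> B \<Longrightarrow> y \<preceq> x"
proof -
  have "\<exists>x \<in> B. \<forall>y \<in> B. y \<preceq> x"
    using assms
  proof (induction B rule: finite_ne_induct)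
    case (insert b B)
    then obtain x where x: "x \<in> B" "\<forall>y \<in> B. y \<preceq> x" by blast
    show ?case
    proof (cases "b \<preceq> x")
      case True
      with x show ?thesis by blast
    next
      case False
      then have "x \<preceq> b"
        by (simp add: not_le strict_def)
      with x have "\<forall>y \<in> B. y \<preceq> b"
        using le_trans by blast
      then show ?thesis by simp
    qed
  qed simp
  with that show ?thesis by blast
qed

text \<open>
  By cancellation in the monomial order, translating both sides by a common vector does not affect
  the comparison, so the extension to \<open>\<int>\<^sup>p\<close> restricts to the given order.
\<close>

lemma int_le_vec_of_nat: "int_le le (vec_of_nat x) (vec_of_nat y) \<longleftrightarrow> x \<preceq> y"
proof
  assume "int_le le (vec_of_nat x) (vec_of_nat y)"
  then obtain a b w where "(vec_of_nat (x + w) :: int ^ 'p) = vec_of_nat a"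
      "(vec_of_nat (y + w) :: int ^ 'p) = vec_of_nat b" "a \<preceq> b"
    by (auto simp: int_le_def)
  then show "x \<preceq> y"
    using add_right_le_iff[of x w y] by (simp del: vec_of_nat_add)
next
  assume "x \<preceq> y"
  then show "int_le le (vec_of_nat x) (vec_of_nat y)"
    unfolding int_le_def by (intro exI[of _ x] exI[of _ y] exI[of _ 0]) simp
qed

lemma strict_int_le_vec_of_nat: "strict (int_le le) (vec_of_nat x) (vec_of_nat y) \<longleftrightarrow> x \<prec> y"
  by (simp add: strict_def int_le_vec_of_nat)

lemma mem_Delta_iff: "x \<in> \<Delta> f \<longleftrightarrow> x = 0 \<or> x \<in> C \<and> f \<prec> x"
  by (auto simp: Delta_def strict_int_le_vec_of_nat)

section \<open>Membership in \<open>\<A>(f)\<close>\<close>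

lemma Frob_full: "Frob C le C $ i = -1"
  by (simp add: Frob_def axis_def)

lemma Frob_greatest_gap:
  assumes "f \<in> C - S" "\<And>x. x \<in> C - S \<Longrightarrow> x \<preceq> f"
  shows "Frob C le S = vec_of_nat f"
  using assms max_wrt_eq[of f "C - S"] by (auto simp: Frob_def)

text \<open>
  The complement of \<open>S\<close> is finite because it lies below \<open>f\<close>, so \<open>C_semigroupI\<close> supplies all requirements on
  generators and cones, and \<open>f\<close> is its greatest element.  Conversely, a non-empty complement has a
  greatest element, which must be \<open>f\<close>; the complement cannot be empty, since the conventional Frobenius
  element has negative coordinates.
\<close>

lemma A_semigroups_iff:
  "S \<in> \<A> f \<longleftrightarrow> S \<subseteq> C \<and> submonoid S \<and> f \<in> C - S \<and> \<Delta> f \<subseteq> S \<and>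
     (\<forall>x \<in> S. \<forall>y \<in> S. consecutive x y \<longrightarrow> f \<prec> x \<or> f \<prec> y)"
    (is "_ \<longleftrightarrow> ?rhs")
proof
  assume S: "S \<in> \<A> f"
  then have semi: "C_semigroup C S" and frob: "Frob C le S = vec_of_nat f"
    and cons: "\<And>s e. s \<in> S \<Longrightarrow> e \<in> canonical_basis \<Longrightarrow> \<not> {s, s + e} \<subseteq> small_elements C le S"
    by (auto simp: A_semigroups_def A_semigroup_def)
  then have sub: "S \<subseteq> C" "submonoid S" and fin: "finite (C - S)"
    by (auto simp: C_semigroup_def)
  have "C - S \<noteq> {}"
  proof
    assume "C - S = {}"
    with sub have "S = C" by auto
    with frob Frob_full have "int (f $ undefined) = -1"
      by (metis vec_of_nat_nth of_nat_id)
    then show False by simp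
  qed
  with fin obtain g where g: "g \<in> C - S" "\<And>y. y \<in> C - S \<Longrightarrow> y \<preceq> g"
    using finite_has_greatest by blast
  with Frob_greatest_gap[of g S] frob have "g = f" by simp
  note f = g[unfolded this]
  have small: "small_elements C le S = {x \<in> S. x \<prec> f}"
    by (simp add: small_elements_def frob strict_int_le_vec_of_nat)
  have "\<Delta> f \<subseteq> S"
  proof
    fix x
    assume "x \<in> \<Delta> f"
    then show "x \<in> S"
      using f(2)[of x] sub(2) not_le[of x f] by (auto simp: mem_Delta_iff submonoid_def)
  qed
  moreover have "f \<prec> x \<or> f \<prec> y" if "x \<in> S" "y \<in> S" "consecutive x y" for x y
  proof (rule ccontr)
    assume "\<not> (f \<prec> x \<or> f \<prec> y)"
    then have "x \<preceq> f" "y \<preceq> f" by (auto simp flip: not_le)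
    with that f have "x \<in> small_elements C le S" "y \<in> small_elements C le S"
      by (auto simp: small strict_def)
    with cons that show False
      by (auto simp: consecutive_def)
  qed
  ultimately show ?rhs
    using sub f by blast
next
  assume R: ?rhs
  have gaps: "x \<preceq> f" if "x \<in> C - S" for x
    using R that not_le[of x f] by (auto simp: mem_Delta_iff subset_iff)
  have frob: "Frob C le S = vec_of_nat f"
    using R gaps by (intro Frob_greatest_gap) auto
  have "finite (C - S)"
    by (rule finite_subset[OF _ finite_below[of f]]) (use R gaps in auto)
  then have "C_semigroup C S"
    using R integer_cone by (intro C_semigroupI) auto
  moreover have "\<not> {s, s + e} \<subseteq> small_elements C le S" if "s \<in> S" "e \<in> canonical_basis" for s e
  proof
    assume "{s, s + e} \<subseteq> small_elements C le S"
    then have "s \<in> S" "s + e \<in> S" "s \<prec> f" "s + e \<prec> f"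
      by (auto simp: small_elements_def frob strict_int_le_vec_of_nat)
    moreover have "consecutive s (s + e)"
      using that by (auto simp: consecutive_def)
    ultimately show False
      using R less_asym by blast
  qed
  ultimately show "S \<in> \<A> f"
    using frob by (auto simp: A_semigroups_def A_semigroup_def)
qed

text \<open>
  Adding an element of \<open>C\<close> to one above \<open>f\<close> stays above \<open>f\<close>, so \<open>\<Delta> f\<close> absorbs sums.
\<close>

lemma submonoid_Un_Delta:
  assumes "submonoid B" "B \<subseteq> C"
  shows "submonoid (B \<union> \<Delta> f)"
proof -
  have "x + y \<in> \<Delta> f \<and> y + x \<in> \<Delta> f" if "x \<in> \<Delta> f" "x \<noteq> 0" "y \<in> C" for x y
    using that integer_cone_submonoid[OF integer_cone] le_add[of x y]
    by (auto simp: mem_Delta_iff submonoid_def intro: less_le_trans)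
  moreover have "\<Delta> f \<subseteq> C"
    using integer_cone_submonoid[OF integer_cone] by (auto simp: mem_Delta_iff submonoid_def)
  ultimately show ?thesis
    using assms unfolding submonoid_def by (metis Un_iff add_0 add_0_right subset_eq)
qed

lemma Un_Delta_in_A_semigroups:
  assumes "submonoid B" "B \<subseteq> C" "f \<in> C" "f \<noteq> 0" "f \<notin> B"
    and cons: "\<And>x y. x \<in> B \<Longrightarrow> y \<in> B \<Longrightarrow> consecutive x y \<Longrightarrow> f \<prec> x \<or> f \<prec> y"
  shows "B \<union> \<Delta> f \<in> \<A> f"
proof -
  have "0 \<in> B"
    using assms(1) by (simp add: submonoid_def)
  then have "f \<prec> x \<or> f \<prec> y" if "x \<in> B \<union> \<Delta> f" "y \<in> B \<union> \<Delta> f" "consecutive x y" for x y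
    using that cons by (auto simp: mem_Delta_iff)
  moreover have "\<Delta> f \<subseteq> C"
    using \<open>0 \<in> B\<close> assms(2) by (auto simp: mem_Delta_iff)
  ultimately show ?thesis
    using assms submonoid_Un_Delta[of B f] by (auto simp: A_semigroups_iff mem_Delta_iff strict_def)
qed

section \<open>The \<open>\<A>(f)\<close>-rank\<close>

text \<open>
  The set \<open>\<langle>X\<rangle> \<union> \<Delta>(f)\<close> inherits from \<open>S\<close> the absence of \<open>f\<close> and of consecutive small elements, so it is
  itself a member of \<open>\<A>(f)\<close>, and every member that contains \<open>X\<close> contains it.
\<close>

lemma A_closure_eq:
  assumes S: "S \<in> \<A> f" and X: "X \<subseteq> S"
  shows "A_closure C le (vec_of_nat f) X = monoid_span X \<union> \<Delta> f"
proof
  have span: "monoid_span X \<subseteq> S"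
    using S X by (intro monoid_span_minimal) (auto simp: A_semigroups_iff)
  have "f \<noteq> 0"
    using S by (auto simp: A_semigroups_iff submonoid_def)
  moreover have "f \<prec> x \<or> f \<prec> y"
    if "x \<in> monoid_span X" "y \<in> monoid_span X" "consecutive x y" for x y
    using S span that unfolding A_semigroups_iff by blast
  ultimately have "monoid_span X \<union> \<Delta> f \<in> \<A> f"
    using S span by (intro Un_Delta_in_A_semigroups submonoid_monoid_span) (auto simp: A_semigroups_iff)
  then show "A_closure C le (vec_of_nat f) X \<subseteq> monoid_span X \<union> \<Delta> f"
    using monoid_span_superset[of X] by (auto simp: A_closure_def)
  show "monoid_span X \<union> \<Delta> f \<subseteq> A_closure C le (vec_of_nat f) X"
    unfolding A_closure_def
  proof (rule Inter_greatest)
    fix T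
    assume "T \<in> {S \<in> \<A> f. X \<subseteq> S}"
    then show "monoid_span X \<union> \<Delta> f \<subseteq> T"
      using monoid_span_minimal[of X T] by (auto simp: A_semigroups_iff)
  qed
qed

lemma A_generators_iff:
  assumes S: "S \<in> \<A> f"
  shows "A_generators C le (vec_of_nat f) S X \<longleftrightarrow> X \<subseteq> S - \<Delta> f \<and> S = monoid_span X \<union> \<Delta> f"
proof
  assume X: "A_generators C le (vec_of_nat f) S X"
  then have "S = monoid_span X \<union> \<Delta> f"
    using A_closure_eq by (auto simp: A_generators_def A_set_def)
  with X monoid_span_superset[of X] show "X \<subseteq> S - \<Delta> f \<and> S = monoid_span X \<union> \<Delta> f"
    by (auto simp: A_generators_def A_set_def)
next
  assume "X \<subseteq> S - \<Delta> f \<and> S = monoid_span X \<union> \<Delta> f"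
  with S show "A_generators C le (vec_of_nat f) S X"
    using A_closure_eq[OF S, of X] by (auto simp: A_generators_def A_set_def)
qed

lemma A_generators_atoms:
  assumes S: "S \<in> \<A> f"
  shows "A_generators C le (vec_of_nat f) S (atoms S - \<Delta> f)"
proof -
  have sub: "submonoid S" "\<Delta> f \<subseteq> S" "S \<subseteq> C"
    using S by (auto simp: A_semigroups_iff)
  have "s \<in> monoid_span (atoms S - \<Delta> f)" if s: "s \<in> S" "s \<notin> \<Delta> f" for s
  proof -
    have "s \<preceq> f"
      using s sub not_le[of s f] by (auto simp: mem_Delta_iff)
    then have "{a \<in> atoms S. a \<le> s} \<subseteq> atoms S - \<Delta> f"
      using le_trans[OF componentwise_le_imp_le]
      by (auto simp: atoms_def mem_Delta_iff simp flip: not_le)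
    then show ?thesis
      using mem_monoid_span_atoms_below[OF s(1)] monoid_span_mono by blast
  qed
  moreover have "monoid_span (atoms S - \<Delta> f) \<subseteq> S"
    using sub by (intro monoid_span_minimal) (auto simp: atoms_def)
  ultimately show ?thesis
    using sub unfolding A_generators_iff[OF S] by (auto simp: atoms_def)
qed

lemma atoms_subset_A_generators:
  assumes S: "S \<in> \<A> f" and X: "A_generators C le (vec_of_nat f) S X"
  shows "atoms S - \<Delta> f \<subseteq> X"
proof
  fix a
  assume a: "a \<in> atoms S - \<Delta> f"
  have X: "X \<subseteq> S" "S = monoid_span X \<union> \<Delta> f"
    using X by (auto simp: A_generators_iff[OF S])
  have "a \<in> S"
    using a by (auto simp: atoms_def)
  with a X(2) have "a \<in> monoid_span X" by blast
  moreover have "submonoid S" "a \<in> atoms S"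
    using S a by (auto simp: A_semigroups_iff)
  ultimately show "a \<in> X"
    using atom_in_generators[OF _ X(1)] by blast
qed

lemma minimal_A_generators_iff:
  assumes S: "S \<in> \<A> f"
  shows "minimal_A_generators C le (vec_of_nat f) S X \<longleftrightarrow> X = atoms S - \<Delta> f"
proof
  assume X: "minimal_A_generators C le (vec_of_nat f) S X"
  then have "atoms S - \<Delta> f \<subseteq> X"
    using atoms_subset_A_generators[OF S] by (simp add: minimal_A_generators_def)
  moreover have "A_closure C le (vec_of_nat f) (atoms S - \<Delta> f) = S"
    using A_generators_atoms[OF S] by (simp add: A_generators_def)
  then have "\<not> atoms S - \<Delta> f \<subset> X"
    using X by (auto simp: minimal_A_generators_def)
  ultimately show "X = atoms S - \<Delta> f" by blast
next
  assume X: "X = atoms S - \<Delta> f"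
  have "A_closure C le (vec_of_nat f) Y \<noteq> S" if "Y \<subset> X" for Y
  proof
    assume "A_closure C le (vec_of_nat f) Y = S"
    then have "A_generators C le (vec_of_nat f) S Y"
      using S that unfolding X A_generators_def A_set_def by (auto simp: atoms_def)
    with atoms_subset_A_generators[OF S] that X show False by blast
  qed
  with X A_generators_atoms[OF S] show "minimal_A_generators C le (vec_of_nat f) S X"
    by (simp add: minimal_A_generators_def)
qed

lemma A_rank_eq_card_atoms:
  assumes "S \<in> \<A> f"
  shows "A_rank C le (vec_of_nat f) S = card (atoms S - \<Delta> f)"
  unfolding A_rank_def minimal_A_generators_iff[OF assms] by simp

text \<open>
  Every element of \<open>C\<close> exceeds the conventional Frobenius element with all coordinates \<open>-1\<close>, so
  \<open>\<Delta>\<close> is all of \<open>C\<close> and only the empty subset of \<open>C\<close> is disjoint from it; it generates, as \<open>C\<close> is the only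
  semigroup with this Frobenius element.
\<close>

lemma A_rank_full:
  assumes "C \<in> A_semigroups C le f"
  shows "A_rank C le f C = 0"
proof -
  have f: "f = Frob C le C"
    using assms by (auto simp: A_semigroups_def)
  have Delta: "x \<in> Delta C le f" if "x \<in> C" for x
  proof -
    have "f + vec_of_nat 1 = vec_of_nat 0" "vec_of_nat x + vec_of_nat 1 = (vec_of_nat (x + 1) :: int ^ 'p)"
      by (simp_all add: vec_eq_iff f Frob_full)
    moreover have "0 \<preceq> x + 1" by simp
    ultimately have "int_le le f (vec_of_nat x)"
      unfolding int_le_def by blast
    moreover have "f $ undefined \<noteq> vec_of_nat x $ undefined"
      by (simp add: f Frob_full)
    ultimately show ?thesis
      using that by (auto simp: Delta_def strict_def)
  qed
  have only: "T = C" if T: "T \<in> A_semigroups C le f" for T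
  proof (rule ccontr)
    assume "T \<noteq> C"
    with T have "C - T \<noteq> {}" "Frob C le T = f"
      by (auto simp: A_semigroups_def A_semigroup_def C_semigroup_def)
    then have "int (max_wrt le (C - T) $ undefined) = f $ undefined"
      by (auto simp: Frob_def)
    then show False
      by (simp add: f Frob_full)
  qed
  have "minimal_A_generators C le f C X \<longleftrightarrow> X = {}" for X
  proof
    assume "minimal_A_generators C le f C X"
    then show "X = {}"
      using only Delta by (fastforce simp: minimal_A_generators_def A_generators_def A_set_def)
  next
    have "A_closure C le f {} = C"
      using assms only by (auto simp: A_closure_def)
    moreover assume "X = {}"
    ultimately show "minimal_A_generators C le f C X"
      using assms by (auto simp: minimal_A_generators_def A_generators_def A_set_def)
  qed
  then show ?thesis
    by (simp add: A_rank_def)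
qed

section \<open>Semigroups of rank two\<close>

lemma le_of_mem_monoid_span_insert:
  assumes "x \<in> monoid_span (insert a B)" "x \<notin> monoid_span B"
  shows "a \<preceq> x"
  using monoid_span_insert_cases[OF assms(1)] assms(2) le_add(1)[of a] by auto

lemma least_nonzero_of_span_pair:
  assumes "x \<in> monoid_span {m, r}" "x \<noteq> 0" "m \<prec> r"
  shows "m \<preceq> x"
proof (cases "x \<in> monoid_span {m}")
  case True
  then show ?thesis
    using le_of_mem_monoid_span_insert[of x m "{}"] assms by (simp add: monoid_span_empty)
next
  case False
  then have "r \<preceq> x"
    using le_of_mem_monoid_span_insert[of x r "{m}"] assms by (simp add: insert_commute)
  with assms(3) show ?thesis
    using le_trans by (auto simp: strict_def)
qed

text \<open>
  Both \<open>m\<close> and \<open>r\<close> are atoms.  The summands in a proper decomposition of \<open>m\<close> would be non-zero and smaller than \<open>m\<close>.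
  Those of \<open>r\<close> would be smaller than \<open>r\<close>, hence multiples of \<open>m\<close>, and so would be \<open>r\<close>.  There are no
  other atoms outside \<open>\<Delta>(f)\<close>, since \<open>{m, r}\<close> generates.
\<close>

lemma span_pair_Un_Delta:
  assumes "m \<in> C - {0}" "r \<in> C - {0}" "f \<in> C - {0}" "m \<prec> r" "r \<prec> f"
    and r: "r \<notin> monoid_span {m}" and f: "f \<notin> monoid_span {m, r}"
    and cons: "\<And>x y. x \<in> monoid_span {m, r} \<Longrightarrow> y \<in> monoid_span {m, r} \<Longrightarrow> consecutive x y
      \<Longrightarrow> f \<prec> x \<or> f \<prec> y"
  defines "S \<equiv> monoid_span {m, r} \<union> \<Delta> f"
  shows "S \<in> \<A> f" and "A_rank C le (vec_of_nat f) S = 2"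
proof -
  have "monoid_span {m, r} \<subseteq> C"
    using assms integer_cone_submonoid[OF integer_cone] by (intro monoid_span_minimal) auto
  with assms show S: "S \<in> \<A> f"
    unfolding S_def by (intro Un_Delta_in_A_semigroups submonoid_monoid_span) auto
  have mr: "m \<in> monoid_span {m, r}" "r \<in> monoid_span {m, r}"
    using monoid_span_superset[of "{m, r}"] by auto
  have "m \<prec> f"
    using \<open>m \<prec> r\<close> \<open>r \<prec> f\<close> by (rule less_trans)
  have not_Delta: "m \<notin> \<Delta> f" "r \<notin> \<Delta> f"
    using assms(1,2) less_asym[OF \<open>m \<prec> f\<close>] less_asym[OF \<open>r \<prec> f\<close>] by (auto simp: mem_Delta_iff)
  \<comment> \<open>Below \<open>f\<close> the set \<open>\<Delta> f\<close> contributes no non-zero summands.\<close>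
  have summand: "x \<in> monoid_span {m, r} \<and> x \<prec> x + y \<and> y \<in> monoid_span {m, r} \<and> y \<prec> x + y"
    if "x \<in> S" "y \<in> S" "x \<noteq> 0" "y \<noteq> 0" "x + y \<prec> f" for x y
  proof -
    have "x \<prec> x + y" "y \<prec> x + y"
      using that le_add by (auto simp: strict_def)
    then have "x \<prec> f" "y \<prec> f"
      using less_trans that(5) by blast+
    then have "x \<notin> \<Delta> f" "y \<notin> \<Delta> f"
      using that(3,4) less_asym by (auto simp: mem_Delta_iff)
    with that \<open>x \<prec> x + y\<close> \<open>y \<prec> x + y\<close> show ?thesis
      by (auto simp: S_def)
  qed
  have "m \<in> atoms S"
  proof -
    have False if "x \<in> S" "y \<in> S" "m = x + y" "x \<noteq> 0" "y \<noteq> 0" for x y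
    proof -
      have "x \<in> monoid_span {m, r}" "x \<prec> m"
        using summand[of x y] that \<open>m \<prec> f\<close> by auto
      with least_nonzero_of_span_pair[of x m r] that(4) \<open>m \<prec> r\<close> less_not_le show False
        by blast
    qed
    moreover have "m \<in> S" "m \<noteq> 0"
      using mr assms(1) by (auto simp: S_def)
    ultimately show ?thesis
      unfolding atoms_def by blast
  qed
  moreover have "r \<in> atoms S"
  proof -
    have False if xy: "x \<in> S" "y \<in> S" "r = x + y" "x \<noteq> 0" "y \<noteq> 0" for x y
    proof -
      have "z \<in> monoid_span {m}" if "z \<in> monoid_span {m, r}" "z \<prec> r" for z
        using le_of_mem_monoid_span_insert[of z r "{m}"] that less_not_le
        by (auto simp: insert_commute)
      then have "x \<in> monoid_span {m}" "y \<in> monoid_span {m}"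
        using summand[of x y] xy \<open>r \<prec> f\<close> by auto
      with r xy show False by (simp add: monoid_span_add)
    qed
    moreover have "r \<in> S" "r \<noteq> 0"
      using mr assms(2) by (auto simp: S_def)
    ultimately show ?thesis
      unfolding atoms_def by blast
  qed
  moreover have "atoms S - \<Delta> f \<subseteq> {m, r}"
  proof (rule atoms_subset_A_generators[OF S])
    show "A_generators C le (vec_of_nat f) S {m, r}"
      unfolding A_generators_iff[OF S] using mr not_Delta by (auto simp: S_def)
  qed
  ultimately have "atoms S - \<Delta> f = {m, r}"
    using not_Delta by blast
  with S \<open>m \<prec> r\<close> show "A_rank C le (vec_of_nat f) S = 2"
    by (simp add: A_rank_eq_card_atoms strict_def)
qed

text \<open>
  The two atoms below \<open>f\<close>, in increasing order, turn out to be the multiplicity and the ratio: an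
  element of \<open>S\<close> outside \<open>\<langle>m\<rangle>\<close> either involves \<open>r\<close> or lies above \<open>f\<close>.
\<close>

lemma rank_two_cases:
  assumes S: "S \<in> A_semigroups C le f'" and rank: "A_rank C le f' S = 2"
  obtains f where "f \<in> C - {0}" "f' = vec_of_nat f"
    "multiplicity_of le S \<in> C - {0}" "ratio_of le S \<in> C - {0}"
    "multiplicity_of le S \<prec> ratio_of le S" "ratio_of le S \<prec> f"
    "ratio_of le S \<notin> monoid_span {multiplicity_of le S}"
    "S = monoid_span {multiplicity_of le S, ratio_of le S} \<union> \<Delta> f"
proof -
  have "S \<subseteq> C" and fin: "finite (C - S)" and f': "f' = Frob C le S"
    using S by (auto simp: A_semigroups_def A_semigroup_def C_semigroup_def)
  have "S \<noteq> C"
    using S rank A_rank_full by fastforce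
  with \<open>S \<subseteq> C\<close> fin obtain f where f: "f' = vec_of_nat f"
    using f' Frob_def by (metis Diff_eq_empty_iff subset_antisym)
  note S = S[unfolded f]
  have sub: "submonoid S" "f \<in> C - S"
    using S by (auto simp: A_semigroups_iff)
  then have "f \<noteq> 0" by (auto simp: submonoid_def)
  have "card (atoms S - \<Delta> f) = 2"
    using rank by (simp add: f A_rank_eq_card_atoms[OF S])
  then obtain a b where ab: "atoms S - \<Delta> f = {a, b}" "a \<noteq> b"
    by (auto simp: card_2_iff)
  then obtain m r where mr: "atoms S - \<Delta> f = {m, r}" "m \<prec> r"
    using not_le[of a b] by (cases "a \<preceq> b") (auto simp: strict_def insert_commute)
  have S_eq: "S = monoid_span {m, r} \<union> \<Delta> f"
    using A_generators_atoms[OF S] by (simp add: A_generators_iff[OF S] mr)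
  have atom: "m \<in> atoms S" "r \<in> atoms S" "m \<notin> \<Delta> f" "r \<notin> \<Delta> f"
    using mr by auto
  then have S_mem: "m \<in> S" "r \<in> S" "m \<noteq> 0" "r \<noteq> 0"
    by (auto simp: atoms_def)
  have "r \<prec> f"
    using atom S_mem sub \<open>S \<subseteq> C\<close> not_le[of r f] by (auto simp: mem_Delta_iff strict_def)
  have r: "r \<notin> monoid_span {m}"
    using atom_in_generators[of S "{m}" r] sub atom S_mem mr(2) by (auto simp: strict_def)
  have Delta_ge: "r \<preceq> x \<and> m \<preceq> x" if "x \<in> \<Delta> f" "x \<noteq> 0" for x
    using that \<open>r \<prec> f\<close> mr(2) le_trans unfolding mem_Delta_iff strict_def by blast
  have m_eq: "multiplicity_of le S = m"
    unfolding multiplicity_of_def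
    using S_mem Delta_ge least_nonzero_of_span_pair[OF _ _ mr(2)] S_eq by (intro min_wrt_eq) auto
  have "r \<preceq> x" if "x \<in> S" "x \<notin> monoid_span {m}" for x
    using that Delta_ge le_of_mem_monoid_span_insert[of x r "{m}"] S_eq monoid_span_zero[of "{m}"]
    by (auto simp: insert_commute)
  then have r_eq: "ratio_of le S = r"
    unfolding ratio_of_def m_eq using S_mem r by (intro min_wrt_eq) auto
  show thesis
    using that[of f] f sub \<open>f \<noteq> 0\<close> \<open>S \<subseteq> C\<close> S_mem mr(2) \<open>r \<prec> f\<close> r S_eq
    unfolding m_eq r_eq by blast
qed

end

theorem theorem15:
  fixes C :: "(nat ^ 'p) set"
    and le :: "nat ^ 'p \<Rightarrow> nat ^ 'p \<Rightarrow> bool"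
  assumes "integer_cone C"
    and "card (extremal_rays C) \<ge> CARD('p)"
    and "monomial_order le"
    and "\<forall>k \<in> C. finite {x \<in> C. le x k}"
  shows
    "(\<forall>m \<in> C - {0}. \<forall>r \<in> C - {0}. \<forall>f \<in> C - {0}.
        \<not> C_semigroup C (monoid_span {m, r}) \<and>
        strict le m r \<and> strict le r f \<and>
        r \<notin> monoid_span {m} \<and> f \<notin> monoid_span {m, r} \<and>
        (\<forall>x \<in> monoid_span {m, r}. \<forall>y \<in> monoid_span {m, r}.
           consecutive x y \<longrightarrow> strict le f x \<or> strict le f y) \<longrightarrow>
        (let S = monoid_span {m, r} \<union> Delta C le (vec_of_nat f) in
           S \<in> A_semigroups C le (vec_of_nat f) \<and> A_rank C le (vec_of_nat f) S = 2))
   \<and> (\<forall>S f'. S \<in> A_semigroups C le f' \<and> A_rank C le f' S = 2 \<and>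
        \<not> C_semigroup C (monoid_span {multiplicity_of le S, ratio_of le S}) \<longrightarrow>
        (\<exists>m \<in> C - {0}. \<exists>r \<in> C - {0}. \<exists>f \<in> C - {0}.
           f' = vec_of_nat f \<and>
           \<not> C_semigroup C (monoid_span {m, r}) \<and>
           strict le m r \<and> strict le r f \<and>
           r \<notin> monoid_span {m} \<and> f \<notin> monoid_span {m, r} \<and>
           (\<forall>x \<in> monoid_span {m, r}. \<forall>y \<in> monoid_span {m, r}.
              consecutive x y \<longrightarrow> strict le f x \<or> strict le f y) \<and>
           S = monoid_span {m, r} \<union> Delta C le (vec_of_nat f)))"
proof -
  interpret ordered_integer_cone C le
    using assms by unfold_locales auto
  show ?thesis
    unfolding Let_def
  proof (intro conjI ballI allI impI; (elim conjE)?)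
    fix m r f
    assume mrf: "m \<in> C - {0}" "r \<in> C - {0}" "f \<in> C - {0}" "strict le m r" "strict le r f"
      "r \<notin> monoid_span {m}" "f \<notin> monoid_span {m, r}"
      "\<forall>x \<in> monoid_span {m, r}. \<forall>y \<in> monoid_span {m, r}.
         consecutive x y \<longrightarrow> strict le f x \<or> strict le f y"
    show "monoid_span {m, r} \<union> \<Delta> f \<in> \<A> f"
      by (rule span_pair_Un_Delta) (use mrf in auto)
    show "A_rank C le (vec_of_nat f) (monoid_span {m, r} \<union> \<Delta> f) = 2"
      by (rule span_pair_Un_Delta) (use mrf in auto)
  next
    fix S f'
    assume S: "S \<in> A_semigroups C le f'" "A_rank C le f' S = 2"
      and not_C: "\<not> C_semigroup C (monoid_span {multiplicity_of le S, ratio_of le S})"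
    let ?m = "multiplicity_of le S" and ?r = "ratio_of le S"
    obtain f where f: "f \<in> C - {0}" "f' = vec_of_nat f" "?m \<in> C - {0}" "?r \<in> C - {0}"
      "strict le ?m ?r" "strict le ?r f" "?r \<notin> monoid_span {?m}"
      "S = monoid_span {?m, ?r} \<union> \<Delta> f"
      using rank_two_cases[OF S] by metis
    have S_props: "f \<notin> S" "\<forall>x \<in> S. \<forall>y \<in> S. consecutive x y \<longrightarrow> strict le f x \<or> strict le f y"
      using S(1) unfolding f(2) A_semigroups_iff by auto
    have sub: "monoid_span {?m, ?r} \<subseteq> S"
      by (subst (3) f(8)) (rule Un_upper1)
    have f_notin: "f \<notin> monoid_span {?m, ?r}"
      using S_props(1) sub by (rule contra_subsetD[rotated])
    have cons: "\<forall>x \<in> monoid_span {?m, ?r}. \<forall>y \<in> monoid_span {?m, ?r}.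
        consecutive x y \<longrightarrow> strict le f x \<or> strict le f y"
      using S_props(2) subsetD[OF sub] by simp
    show "\<exists>m \<in> C - {0}. \<exists>r \<in> C - {0}. \<exists>f \<in> C - {0}.
           f' = vec_of_nat f \<and>
           \<not> C_semigroup C (monoid_span {m, r}) \<and>
           strict le m r \<and> strict le r f \<and>
           r \<notin> monoid_span {m} \<and> f \<notin> monoid_span {m, r} \<and>
           (\<forall>x \<in> monoid_span {m, r}. \<forall>y \<in> monoid_span {m, r}.
              consecutive x y \<longrightarrow> strict le f x \<or> strict le f y) \<and>
           S = monoid_span {m, r} \<union> Delta C le (vec_of_nat f)"
      by (rule bexI[of _ ?m], rule bexI[of _ ?r], rule bexI[of _ f], intro conjI)
        (fact f not_C f_notin cons)+
  qed
qed

end
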